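(* Let $\mu$ be a positive finite Borel measure on $[0,1)$, let $\mu_n=\int_0^1 t^n\,d\mu(t)$, $n\ge 0$, be its moments, and let $R_\mu$ be the Rhaly operator associated to the moment sequence $(\mu_n)_{n\ge 0}$. Assume that $R_\mu$ is a bounded operator on $\ell^2$, and let $$s_n=\sum_{j=0}^n \mu_j=\int_0^1\frac{1-t^{n+1}}{1-t}\,d\mu(t)\qquad(n\ge 0).$$ Then, for a given index $k$, $\mu_k\in\sigma_p(R_\mu)$ if and only if the sequence $(\mu_n\exp(s_n/\mu_k))_{n\ge 0}$ is in $\ell^2$. Moreover, $$\sigma_p(R_\mu)=\{\mu_k:\ (\mu_n\exp(s_n/\mu_k))_{n\ge 0}\in\ell^2\}.$$
   Context: $\ell^2=\ell^2(\mathbb{N}_0)$ is the complex Hilbert space of square-summable sequences $(x_n)_{n\ge 0}$. The Rhaly operator $R_\mu$ associated to the moment sequence $(\mu_n)_{n\ge 0}$ is given by the lower triangular matrix whose $(n,k)$ entry is $\mu_n$ for $0\le k\le n$ and $0$ for $k>n$, i.e. $(R_\mu x)_n=\mu_n\sum_{k=0}^n x_k$. $\sigma_p(T)$ denotes the point spectrum (set of eigenvalues) of a bounded operator $T$. Indices $k$ range over the integers $k\ge 0$, and $0^0=1$, so that $\mu_0=\mu([0,1))$. *)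

theory Defs
  imports "HOL-Analysis.Analysis"
begin

definition ell2 :: "(nat \<Rightarrow> complex) set" where
  "ell2 = {x. summable (\<lambda>n. (cmod (x n))\<^sup>2)}"

definition ell2_norm :: "(nat \<Rightarrow> complex) \<Rightarrow> real" where
  "ell2_norm x = sqrt (\<Sum>n. (cmod (x n))\<^sup>2)"

text \<open>Operators are maps on all complex sequences; only their restriction to
  \<^const>\<open>ell2\<close> matters.\<close>

definition bounded_operator_ell2 :: "((nat \<Rightarrow> complex) \<Rightarrow> nat \<Rightarrow> complex) \<Rightarrow> bool" where
  "bounded_operator_ell2 T \<longleftrightarrow>
     (\<forall>x\<in>ell2. T x \<in> ell2) \<and>
     (\<forall>x\<in>ell2. \<forall>y\<in>ell2. T (\<lambda>n. x n + y n) = (\<lambda>n. T x n + T y n)) \<and>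
     (\<forall>c. \<forall>x\<in>ell2. T (\<lambda>n. c * x n) = (\<lambda>n. c * T x n)) \<and>
     (\<exists>C. \<forall>x\<in>ell2. ell2_norm (T x) \<le> C * ell2_norm x)"

definition point_spectrum :: "((nat \<Rightarrow> complex) \<Rightarrow> nat \<Rightarrow> complex) \<Rightarrow> complex set" where
  "point_spectrum T = {z. \<exists>x\<in>ell2. x \<noteq> (\<lambda>n. 0) \<and> T x = (\<lambda>n. z * x n)}"

definition rhaly :: "(nat \<Rightarrow> real) \<Rightarrow> (nat \<Rightarrow> complex) \<Rightarrow> nat \<Rightarrow> complex" where
  "rhaly a x = (\<lambda>n. complex_of_real (a n) * (\<Sum>k\<le>n. x k))"

definition moment :: "real measure \<Rightarrow> nat \<Rightarrow> real" where
  "moment M n = (LINT t|M. t ^ n)"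

text \<open>In the quotients \<open>s\<^sub>n / \<mu>\<^sub>k\<close> a moment \<open>\<mu>\<^sub>k\<close> vanishes only if \<open>\<mu>\<close> is zero
  or, for \<open>k \<ge> 1\<close>, a multiple of the Dirac measure at 0. The quotient is then 0 by the
  convention for division by zero, so the sequence \<open>\<mu>\<^sub>n exp (s\<^sub>n / \<mu>\<^sub>k)\<close> is \<open>\<mu>\<^sub>n\<close>, in
  agreement with 0 being an eigenvalue of the Rhaly operator.\<close>

definition moment_sum :: "real measure \<Rightarrow> nat \<Rightarrow> real" where
  "moment_sum M n = (\<Sum>j\<le>n. moment M j)"

lemma moment_sum_eq_integral:
  fixes M :: "real measure"
  assumes "finite_measure M" and M: "sets M = sets (restrict_space borel {0..<1})"
  shows "moment_sum M n = (LINT t|M. (1 - t ^ (n + 1)) / (1 - t))"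
proof -
  interpret finite_measure M by fact
  have sp: "space M = {0..<1}"
    using sets_eq_imp_space_eq[OF M] by (simp add: space_restrict_space)
  have meas: "(\<lambda>t. t ^ j) \<in> borel_measurable M" for j :: nat
    unfolding measurable_cong_sets[OF M refl]
    by (intro measurable_restrict_space1) measurable
  have int: "integrable M (\<lambda>t. t ^ j)" for j :: nat
    by (rule integrable_const_bound[where B = 1])
       (auto intro!: AE_I2 meas simp: sp power_le_one)
  have "moment_sum M n = (LINT t|M. (\<Sum>j\<le>n. t ^ j))"
    unfolding moment_sum_def moment_def
    by (rule Bochner_Integration.integral_sum[symmetric]) (rule int)
  also have "\<dots> = (LINT t|M. (1 - t ^ (n + 1)) / (1 - t))"
    by (rule Bochner_Integration.integral_cong) (auto simp: sp sum_gp0)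
  finally show ?thesis .
qed

end

(* A nonzero eigenvector x has a first nonzero partial sum, at some index k, which forces the
   eigenvalue to be \<mu>_k; the partial sums S_n then satisfy (1 - \<mu>_n/\<mu>_k) S_n = S_(n-1) for n > k,
   so S_n is a multiple of the inverse of the product of the factors 1 - \<mu>_j/\<mu>_k, k < j \<le> n, and
   x_n = \<mu>_n S_n / \<mu>_k.  The moments are square summable, being the image of the first basis
   vector, so this product is comparable to exp (-s_n/\<mu>_k). *)
theory Submission
  imports Defs
begin

section \<open>Membership in \<open>ell2\<close> by comparison\<close>

lemma ell2_dominated:
  assumes "x \<in> ell2" and "\<And>n. n \<ge> N \<Longrightarrow> cmod (y n) \<le> C * cmod (x n)"
  shows "y \<in> ell2"
proof -
  have "summable (\<lambda>n. C\<^sup>2 * (cmod (x n))\<^sup>2)"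
    using assms(1) by (intro summable_mult) (simp add: ell2_def)
  moreover have "norm ((cmod (y n))\<^sup>2) \<le> C\<^sup>2 * (cmod (x n))\<^sup>2" if "n \<ge> N" for n
    using power_mono[OF assms(2)[OF that] norm_ge_zero, of 2] by (simp add: power_mult_distrib)
  ultimately show ?thesis
    unfolding ell2_def mem_Collect_eq by (rule summable_comparison_test')
qed

lemma ell2_finite_support: "(\<And>n. n \<ge> N \<Longrightarrow> x n = 0) \<Longrightarrow> x \<in> ell2"
  by (rule ell2_dominated[where x = "\<lambda>n. 0" and N = N and C = 0]) (auto simp: ell2_def)

section \<open>Products of factors \<open>1 - u j\<close> against exponentials\<close>

text \<open>For \<open>j > k\<close> the factor \<open>(1 - u j) * exp (u j)\<close> differs from 1
  only to second order in \<open>u j\<close>, so square summability bounds the whole product away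
  from 0. The sum starts at 0 but the product at \<open>Suc k\<close>; the indices up to
  \<open>k\<close> contribute just the constant \<open>exp (\<Sum>j\<le>k. u j)\<close>.\<close>

lemma prod_one_minus_times_exp_bounds:
  fixes u :: "nat \<Rightarrow> real"
  assumes nonneg: "\<And>j. 0 \<le> u j" and le: "\<And>j. j > k \<Longrightarrow> u j \<le> r" and "r < 1"
    and "summable (\<lambda>j. (u j)\<^sup>2)"
  obtains c where "c > 0"
    "\<And>n. n \<ge> k \<Longrightarrow> c \<le> (\<Prod>j=Suc k..n. 1 - u j) * exp (\<Sum>j\<le>n. u j)"
    "\<And>n. n \<ge> k \<Longrightarrow> (\<Prod>j=Suc k..n. 1 - u j) * exp (\<Sum>j\<le>n. u j) \<le> exp (\<Sum>j\<le>k. u j)"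
proof -
  \<comment> \<open>\<open>K\<close> bounds \<open>1 / (1 - u j)\<close> for all
    \<open>j > k\<close>; it becomes the coefficient of the quadratic error.\<close>
  define K where "K = 1 / (1 - r)"
  define q where "q n = (\<Prod>j=Suc k..n. 1 - u j) * exp (\<Sum>j\<le>n. u j)" for n
  have q_Suc: "q (Suc n) = q n * ((1 - u (Suc n)) * exp (u (Suc n)))" if "n \<ge> k" for n
    using that by (simp add: q_def exp_add)
  have K: "K > 0"
    using \<open>r < 1\<close> by (simp add: K_def)
  have "u j < 1" if "j > k" for j
    using le[OF that] \<open>r < 1\<close> by simp
  then have q_pos: "q n > 0" for n
    unfolding q_def by (intro mult_pos_pos prod_pos) auto
  have upper: "q n \<le> exp (\<Sum>j\<le>k. u j)" if "n \<ge> k" for n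
    using that
  proof (induction n rule: dec_induct)
    case base
    show ?case by (simp add: q_def)
  next
    case (step n)
    let ?v = "u (Suc n)"
    have "(1 - ?v) * exp ?v \<le> exp (- ?v) * exp ?v"
      using exp_ge_add_one_self[of "- ?v"] by (intro mult_right_mono) auto
    then have "(1 - ?v) * exp ?v \<le> 1"
      by (simp flip: exp_add)
    then have "q (Suc n) \<le> q n"
      using q_Suc[OF step(1)] q_pos[of n] by (simp add: mult_left_le)
    then show ?case using step by simp
  qed
  \<comment> \<open>Including the squares with index at most \<open>k\<close> only weakens the
    bound, and lets the full series replace the partial sum afterwards.\<close>
  have lower: "exp (- (K * (\<Sum>j\<le>n. (u j)\<^sup>2))) \<le> q n" if "n \<ge> k" for n
    using that
  proof (induction n rule: dec_induct)
    case base
    have "- (K * (\<Sum>j\<le>k. (u j)\<^sup>2)) \<le> 0"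
      using K by (simp add: sum_nonneg)
    also have "0 \<le> (\<Sum>j\<le>k. u j)"
      using nonneg by (simp add: sum_nonneg)
    finally show ?case by (simp add: q_def)
  next
    case (step n)
    let ?v = "u (Suc n)"
    have v: "0 \<le> ?v" "?v \<le> r" "?v < 1"
      using nonneg le[of "Suc n"] step(1) \<open>r < 1\<close> by auto
    \<comment> \<open>The aim is a lower bound for \<open>1 - ?v\<close>: its inverse is
      \<open>1 + ?v / (1 - ?v)\<close>, hence at most \<open>exp (?v / (1 - ?v))\<close>, and this
      exponent exceeds \<open>?v\<close> by at most \<open>K\<close> times the square of
      \<open>?v\<close>.\<close>
    have "?v / (1 - ?v) = ?v + ?v\<^sup>2 * (1 / (1 - ?v))"
      using v by (simp add: field_simps power2_eq_square)
    also have "\<dots> \<le> ?v + ?v\<^sup>2 * K"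
      unfolding K_def using v \<open>r < 1\<close>
      by (intro add_left_mono mult_left_mono divide_left_mono mult_pos_pos) auto
    finally have "exp (?v / (1 - ?v)) \<le> exp (?v + K * ?v\<^sup>2)"
      by (simp add: mult.commute)
    moreover have "1 / (1 - ?v) = 1 + ?v / (1 - ?v)"
      using v by (simp add: field_simps)
    ultimately have "1 / (1 - ?v) \<le> exp (?v + K * ?v\<^sup>2)"
      using exp_ge_add_one_self[of "?v / (1 - ?v)"] by linarith
    then have "exp (- (K * ?v\<^sup>2)) \<le> (1 - ?v) * exp ?v"
      using v by (simp add: field_simps exp_add exp_minus)
    then have "exp (- (K * (\<Sum>j\<le>n. (u j)\<^sup>2))) * exp (- (K * ?v\<^sup>2))
        \<le> q n * ((1 - ?v) * exp ?v)"
      using step(3) q_pos[of n] by (intro mult_mono) auto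
    then show ?case
      using q_Suc[OF step(1)] by (simp add: ring_distribs flip: exp_add)
  qed
  have "exp (- (K * (\<Sum>j. (u j)\<^sup>2))) \<le> q n" if "n \<ge> k" for n
  proof -
    have "(\<Sum>j\<le>n. (u j)\<^sup>2) \<le> (\<Sum>j. (u j)\<^sup>2)"
      using assms(4) by (intro sum_le_suminf) auto
    then have "exp (- (K * (\<Sum>j. (u j)\<^sup>2))) \<le> exp (- (K * (\<Sum>j\<le>n. (u j)\<^sup>2)))"
      using K by simp
    with lower[OF that] show ?thesis by linarith
  qed
  with upper show ?thesis
    using that[of "exp (- (K * (\<Sum>j. (u j)\<^sup>2)))"] by (auto simp: q_def)
qed

section \<open>Eigenvectors of Rhaly matrices\<close>

text \<open>The product is kept as a multiplier of \<open>x n\<close>, since the factors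
  \<open>1 - a j / a k\<close> may vanish under these hypotheses.\<close>

lemma rhaly_eigenvectorD:
  assumes eig: "rhaly a x = (\<lambda>n. z * x n)" and "x \<noteq> (\<lambda>n. 0)" and a: "\<And>n. a n \<noteq> 0"
  obtains k c where "c \<noteq> 0" "z = complex_of_real (a k)"
    "\<And>n. n \<ge> k \<Longrightarrow> x n * complex_of_real (\<Prod>j=Suc k..n. 1 - a j / a k) = c * complex_of_real (a n)"
proof -
  define S where "S n = (\<Sum>i\<le>n. x i)" for n
  have x: "complex_of_real (a n) * S n = z * x n" for n
    using fun_cong[OF eig, of n] by (simp add: rhaly_def S_def)
  have S_0: "S 0 = x 0" and S_Suc: "S (Suc n) = S n + x (Suc n)" for n
    by (simp_all add: S_def)
  have "\<exists>n. S n \<noteq> 0"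
  proof (rule ccontr)
    assume *: "\<not> ?thesis"
    have "x n = 0" for n
      using * S_0 S_Suc[of "n - 1"] by (cases n) auto
    with assms(2) show False by auto
  qed
  define k where "k = (LEAST n. S n \<noteq> 0)"
  have Sk: "S k \<noteq> 0"
    unfolding k_def using \<open>\<exists>n. S n \<noteq> 0\<close> by (rule LeastI_ex)
  have "S n = 0" if "n < k" for n
    using not_less_Least that unfolding k_def by blast
  \<comment> \<open>Hence row \<open>k\<close> of the eigenvalue equation reads
    \<open>a k * S k = z * S k\<close>, and \<open>S k\<close> cancels.\<close>
  then have "S k = x k"
    using S_0 S_Suc by (cases k) auto
  with x[of k] Sk have z: "z = complex_of_real (a k)"
    by simp
  have S: "S n * complex_of_real (\<Prod>j=Suc k..n. 1 - a j / a k) = S k" if "n \<ge> k" for n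
    using that
  proof (induction n rule: dec_induct)
    case base
    show ?case by simp
  next
    case (step n)
    \<comment> \<open>Row \<open>Suc n\<close> with \<open>x (Suc n) = S (Suc n) - S n\<close> and
      \<open>z = a k\<close>, divided by \<open>a k\<close>.\<close>
    have "S n = S (Suc n) * complex_of_real (1 - a (Suc n) / a k)"
      using x[of "Suc n"] S_Suc[of n] a[of k] by (simp add: z field_simps)
    then show ?case
      using step by (simp add: mult_ac)
  qed
  have "x n * complex_of_real (\<Prod>j=Suc k..n. 1 - a j / a k)
      = S k / complex_of_real (a k) * complex_of_real (a n)" if "n \<ge> k" for n
  proof -
    have "x n = complex_of_real (a n) * S n / complex_of_real (a k)"
      using x[of n] a[of k] by (simp add: z)
    then show ?thesis
      using S[OF that] by (simp add: field_simps)
  qed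
  with z Sk a[of k] show ?thesis
    using that[of "S k / complex_of_real (a k)" k] by simp
qed

text \<open>Converse of \<open>rhaly_eigenvectorD\<close>: \<open>y\<close> solves the relation
  found there with \<open>c = 1\<close>, extended by zero below \<open>k\<close>. Its partial sums
  telescope to \<open>a k\<close> over the product.\<close>

lemma rhaly_eigenvectorI:
  assumes "\<And>n. n > k \<Longrightarrow> a n \<noteq> a k" and ak: "a k \<noteq> 0"
  defines "y \<equiv> \<lambda>n. complex_of_real (if n < k then 0 else a n / (\<Prod>j=Suc k..n. 1 - a j / a k))"
  shows "rhaly a y = (\<lambda>n. complex_of_real (a k) * y n)"
proof -
  define p where "p n = (\<Prod>j=Suc k..n. 1 - a j / a k)" for n
  have p: "p n \<noteq> 0" for n
    unfolding p_def using assms(1) ak by (force simp: Suc_le_eq)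
  have "(\<Sum>i\<le>n. if i < k then 0 else a i / p i) = (if n < k then 0 else a k / p n)" for n
  proof (induction n)
    case 0
    show ?case by (simp add: p_def)
  next
    case (Suc n)
    consider "Suc n < k" | "Suc n = k" | "k \<le> n" by linarith
    then show ?case
    proof cases
      case 3
      then have ps: "p (Suc n) = p n * (1 - a (Suc n) / a k)"
        by (simp add: p_def)
      \<comment> \<open>Adding the next term \<open>a (Suc n) / p (Suc n)\<close> leaves
        \<open>a k / p (Suc n)\<close>, the claimed closed form.\<close>
      then have "a k / p n = (a k - a (Suc n)) / p (Suc n)"
        using p[of n] p[of "Suc n"] ak by (simp add: field_simps)
      then show ?thesis
        using 3 Suc by (simp add: diff_divide_distrib)
    qed (use Suc in \<open>auto simp: p_def\<close>)
  qed
  then have "(\<Sum>i\<le>n. y i) = complex_of_real (if n < k then 0 else a k / p n)" for n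
    unfolding y_def p_def[symmetric] of_real_sum[symmetric] by (rule arg_cong)
  then show ?thesis
    by (auto simp: rhaly_def y_def p_def)
qed

text \<open>By \<open>bounds\<close>, the product \<open>p k n\<close> is comparable to
  \<open>exp (- (\<Sum>j\<le>n. a j) / a k)\<close>. The upper bound shows that an eigenvector
  dominates the weighted sequence, the lower bound that the sequence dominates an
  eigenvector.\<close>

lemma point_spectrum_rhaly:
  assumes pos: "\<And>n. a n > 0" and dec: "strict_antimono_on UNIV a" and sq: "summable (\<lambda>n. (a n)\<^sup>2)"
  shows "point_spectrum (rhaly a) =
    {complex_of_real (a k) | k.
       (\<lambda>n. complex_of_real (a n * exp ((\<Sum>j\<le>n. a j) / a k))) \<in> ell2}"
    (is "_ = {_ | k. ?w k \<in> ell2}")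
proof -
  define p where "p k n = (\<Prod>j=Suc k..n. 1 - a j / a k)" for k n
  have less: "a n < a k" if "n > k" for n k
    using dec that by (simp add: monotone_on_def)
  have p_pos: "p k n > 0" for k n
    unfolding p_def using less pos[of k] by (intro prod_pos) auto
  have bounds: "\<exists>c>0. \<exists>C. \<forall>n\<ge>k. c \<le> p k n * exp ((\<Sum>j\<le>n. a j) / a k) \<and>
      p k n * exp ((\<Sum>j\<le>n. a j) / a k) \<le> C" for k
  proof -
    \<comment> \<open>As \<open>a\<close> decreases, the first ratio past \<open>k\<close> serves as
      the uniform bound \<open>r < 1\<close>.\<close>
    have "a j / a k \<le> a (Suc k) / a k" if "j > k" for j
      using that less[of "Suc k" j] pos[of k] by (cases "j = Suc k") (auto simp: divide_right_mono)
    moreover have "a (Suc k) / a k < 1"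
      using less[of k "Suc k"] pos[of k] by simp
    moreover have "summable (\<lambda>j. (a j / a k)\<^sup>2)"
      using sq by (simp add: power_divide summable_divide)
    ultimately obtain c where "c > 0"
      "\<And>n. n \<ge> k \<Longrightarrow> c \<le> p k n * exp (\<Sum>j\<le>n. a j / a k)"
      "\<And>n. n \<ge> k \<Longrightarrow> p k n * exp (\<Sum>j\<le>n. a j / a k) \<le> exp (\<Sum>j\<le>k. a j / a k)"
      using prod_one_minus_times_exp_bounds[of "\<lambda>j. a j / a k" k "a (Suc k) / a k"] pos
      unfolding p_def by (metis divide_nonneg_pos less_imp_le)
    then show ?thesis
      by (auto simp flip: sum_divide_distrib)
  qed
  show ?thesis
  proof (intro equalityI subsetI)
    fix z assume "z \<in> point_spectrum (rhaly a)"
    then obtain x where x: "x \<in> ell2" "x \<noteq> (\<lambda>n. 0)" "rhaly a x = (\<lambda>n. z * x n)"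
      by (auto simp: point_spectrum_def)
    obtain k b where b: "b \<noteq> 0" and z: "z = complex_of_real (a k)"
      and xp: "\<And>n. n \<ge> k \<Longrightarrow> x n * complex_of_real (p k n) = b * complex_of_real (a n)"
      using rhaly_eigenvectorD[OF x(3,2)] pos unfolding p_def by (metis less_irrefl)
    obtain C where C: "\<And>n. n \<ge> k \<Longrightarrow> p k n * exp ((\<Sum>j\<le>n. a j) / a k) \<le> C"
      using bounds[of k] by blast
    have "cmod (?w k n) \<le> C / cmod b * cmod (x n)" if "n \<ge> k" for n
    proof -
      have "cmod (x n) * p k n = cmod b * a n"
        using arg_cong[OF xp[OF that], of cmod] p_pos[of k n] pos[of n] by (simp add: norm_mult)
      then have "cmod (?w k n) = cmod (x n) / cmod b * (p k n * exp ((\<Sum>j\<le>n. a j) / a k))"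
        using b pos[of n] by (simp add: norm_mult field_simps)
      also have "\<dots> \<le> cmod (x n) / cmod b * C"
        using C[OF that] by (intro mult_left_mono) auto
      finally show ?thesis by (simp add: mult.commute)
    qed
    then have "?w k \<in> ell2"
      by (rule ell2_dominated[OF x(1)])
    with z show "z \<in> {complex_of_real (a k) | k. ?w k \<in> ell2}" by auto
  next
    fix z assume "z \<in> {complex_of_real (a k) | k. ?w k \<in> ell2}"
    then obtain k where z: "z = complex_of_real (a k)" and w: "?w k \<in> ell2" by auto
    \<comment> \<open>The eigenvector from \<open>rhaly_eigenvectorI\<close>.\<close>
    define y where "y n = complex_of_real (if n < k then 0 else a n / p k n)" for n
    obtain c where c: "c > 0" "\<And>n. n \<ge> k \<Longrightarrow> c \<le> p k n * exp ((\<Sum>j\<le>n. a j) / a k)"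
      using bounds[of k] by blast
    have "cmod (y n) \<le> 1 / c * cmod (?w k n)" if "n \<ge> k" for n
    proof -
      have "a n / p k n * c \<le> a n / p k n * (p k n * exp ((\<Sum>j\<le>n. a j) / a k))"
        using c(2)[OF that] pos[of n] p_pos[of k n] by (intro mult_left_mono) auto
      also have "\<dots> = a n * exp ((\<Sum>j\<le>n. a j) / a k)"
        using p_pos[of k n] by simp
      finally have "a n / p k n \<le> 1 / c * (a n * exp ((\<Sum>j\<le>n. a j) / a k))"
        using c(1) by (simp add: field_simps)
      then show ?thesis
        using that pos[of n] p_pos[of k n] by (simp add: y_def norm_divide norm_mult)
    qed
    then have "y \<in> ell2"
      by (rule ell2_dominated[OF w])
    moreover have "y \<noteq> (\<lambda>n. 0)"
      using pos[of k] by (auto simp: y_def p_def dest!: fun_cong[of _ _ k])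
    moreover have "rhaly a y = (\<lambda>n. z * y n)"
      unfolding z y_def p_def
      using less pos[of k] by (intro rhaly_eigenvectorI) (auto simp: less_imp_neq)
    ultimately show "z \<in> point_spectrum (rhaly a)"
      unfolding point_spectrum_def by auto
  qed
qed

text \<open>The matrix is diagonal with at most the (0,0) entry nonzero, so the unit vectors are
  eigenvectors. This covers measures concentrated at 0, including the zero measure.\<close>

lemma point_spectrum_rhaly_first_entry:
  assumes a: "\<And>n. n > 0 \<Longrightarrow> a n = 0"
  shows "point_spectrum (rhaly a) = range (\<lambda>k. complex_of_real (a k))"
proof (intro equalityI subsetI)
  fix z assume "z \<in> point_spectrum (rhaly a)"
  then obtain x where x: "x \<noteq> (\<lambda>n. 0)" "rhaly a x = (\<lambda>n. z * x n)"
    by (auto simp: point_spectrum_def)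
  have "z * x 0 = complex_of_real (a 0) * x 0" and "n > 0 \<Longrightarrow> z * x n = 0" for n
    using fun_cong[OF x(2), of 0] fun_cong[OF x(2), of n] a by (auto simp: rhaly_def)
  moreover obtain n where "x n \<noteq> 0"
    using x(1) by auto
  \<comment> \<open>A nonzero coordinate with \<open>n > 0\<close> forces \<open>z = 0\<close>,
    which is the value \<open>a 1\<close>.\<close>
  ultimately have "z = complex_of_real (a 0) \<or> z = complex_of_real (a 1)"
    using a[of 1] by (cases "n = 0") auto
  then show "z \<in> range (\<lambda>k. complex_of_real (a k))" by auto
next
  fix z assume "z \<in> range (\<lambda>k. complex_of_real (a k))"
  then obtain k where z: "z = complex_of_real (a k)" by auto
  define e :: "nat \<Rightarrow> complex" where "e = (\<lambda>n. if n = k then 1 else 0)"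
  have "e \<in> ell2"
    by (rule ell2_finite_support[of "Suc k"]) (auto simp: e_def)
  moreover have "e \<noteq> (\<lambda>n. 0)"
    by (auto simp: e_def fun_eq_iff)
  moreover have "rhaly a e = (\<lambda>n. z * e n)"
  proof
    fix n
    show "rhaly a e n = z * e n"
      using a[of n] a[of k] by (cases "n = 0") (auto simp: rhaly_def e_def z)
  qed
  ultimately show "z \<in> point_spectrum (rhaly a)"
    unfolding point_spectrum_def by auto
qed

section \<open>Moments and the main result\<close>

text \<open>Consecutive moments differ by the integral of \<open>t ^ n * (1 - t)\<close>, which is
  nonnegative on \<open>{0..<1}\<close> with no zero except possibly 0. So the moments decrease
  strictly unless the measure is concentrated at 0; positivity follows because each moment exceeds
  the next, nonnegative one.\<close>

lemma moment_dichotomy: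
  fixes M :: "real measure"
  assumes "finite_measure M" and M: "sets M = sets (restrict_space borel {0..<1})"
  shows "(\<forall>n>0. moment M n = 0) \<or> (\<forall>n. moment M n > 0) \<and> strict_antimono_on UNIV (moment M)"
proof (cases "AE t in M. t = 0")
  case True
  have "moment M n = 0" if "n > 0" for n
    unfolding moment_def using True that
    by (intro integral_eq_zero_AE) (auto elim!: eventually_mono)
  then show ?thesis by blast
next
  case False
  interpret finite_measure M by fact
  have sp: "space M = {0..<1}"
    using sets_eq_imp_space_eq[OF M] by (simp add: space_restrict_space)
  have meas: "(\<lambda>t. t ^ j) \<in> borel_measurable M" for j :: nat
    unfolding measurable_cong_sets[OF M refl]
    by (intro measurable_restrict_space1) measurable
  have int: "integrable M (\<lambda>t. t ^ j)" for j :: nat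
    by (rule integrable_const_bound[where B = 1])
       (auto intro!: AE_I2 meas simp: sp power_le_one)
  have nonneg: "moment M n \<ge> 0" for n
    unfolding moment_def by (rule integral_nonneg_AE) (auto intro!: AE_I2 simp: sp)
  have Suc: "moment M (Suc n) < moment M n" for n
  proof -
    let ?f = "\<lambda>t::real. t ^ n - t ^ Suc n"
    have f: "AE t in M. 0 \<le> ?f t"
      by (auto intro!: AE_I2 simp: sp mult_left_le_one_le)
    have eq: "(LINT t|M. ?f t) = moment M n - moment M (Suc n)"
      unfolding moment_def by (rule Bochner_Integration.integral_diff) (rule int)+
    have "\<not> (AE t in M. ?f t = 0)"
    proof
      assume "AE t in M. ?f t = 0"
      then have "AE t in M. t = 0"
        using AE_space by eventually_elim (auto simp: sp)
      with False show False ..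
    qed
    then have "(LINT t|M. ?f t) \<noteq> 0"
      using integral_nonneg_eq_0_iff_AE[OF Bochner_Integration.integrable_diff[OF int int] f]
      by blast
    moreover have "(LINT t|M. ?f t) \<ge> 0"
      using f by (rule integral_nonneg_AE)
    ultimately show ?thesis using eq by simp
  qed
  then have "moment M n > 0" for n
    using nonneg[of "Suc n"] by (meson le_less_trans)
  moreover have "strict_antimono_on UNIV (moment M)"
    using lift_Suc_mono_less[of "\<lambda>n. - moment M n"] Suc by (auto simp: monotone_on_def)
  ultimately show ?thesis by blast
qed

theorem theorem2p1:
  fixes M :: "real measure"
  assumes "finite_measure M"
    and "sets M = sets (restrict_space borel {0..<1})"
    and "bounded_operator_ell2 (rhaly (moment M))"
  shows "(\<forall>k. complex_of_real (moment M k) \<in> point_spectrum (rhaly (moment M)) \<longleftrightarrow>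
              (\<lambda>n. complex_of_real (moment M n * exp (moment_sum M n / moment M k))) \<in> ell2)
       \<and> point_spectrum (rhaly (moment M)) =
           {complex_of_real (moment M k) | k.
              (\<lambda>n. complex_of_real (moment M n * exp (moment_sum M n / moment M k))) \<in> ell2}"
proof -
  let ?w = "\<lambda>k n. complex_of_real (moment M n * exp (moment_sum M n / moment M k))"
  have spec: "point_spectrum (rhaly (moment M)) = {complex_of_real (moment M k) | k. ?w k \<in> ell2}"
    using moment_dichotomy[OF assms(1,2)]
  proof
    assume *: "\<forall>n>0. moment M n = 0"
    \<comment> \<open>Each sequence is supported at index 0, whatever the quotient in the exponent,
      so the condition holds for every \<open>k\<close> and the set is the full range of
      moments.\<close>
    have "?w k \<in> ell2" for k
      using * by (intro ell2_finite_support[of 1]) auto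
    with * show ?thesis
      by (auto simp: point_spectrum_rhaly_first_entry)
  next
    assume *: "(\<forall>n. moment M n > 0) \<and> strict_antimono_on UNIV (moment M)"
    let ?e = "\<lambda>n::nat. if n = 0 then 1 else 0 :: complex"
    have "?e \<in> ell2"
      by (rule ell2_finite_support[of 1]) auto
    then have "rhaly (moment M) ?e \<in> ell2"
      using assms(3) unfolding bounded_operator_ell2_def by blast
    moreover have "rhaly (moment M) ?e = (\<lambda>n. complex_of_real (moment M n))"
      by (simp add: rhaly_def)
    ultimately have "summable (\<lambda>n. (moment M n)\<^sup>2)"
      by (simp add: ell2_def)
    with * show ?thesis
      unfolding moment_sum_def by (intro point_spectrum_rhaly) auto
  qed
  text \<open>The sequence depends on \<open>k\<close> only through the value \<open>\<mu>\<^sub>k\<close>, so the first claim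
    follows from the description of the point spectrum even if moments coincide.\<close>
  have "complex_of_real (moment M k) \<in> point_spectrum (rhaly (moment M)) \<longleftrightarrow> ?w k \<in> ell2" for k
    unfolding spec by (auto dest!: of_real_eq_iff[THEN iffD1])
  with spec show ?thesis by blast
qed

end
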